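(* Let $\mathcal{D}$ be a finite-dimensional real associative algebra endowed with a division grading $\mathcal{D}=\bigoplus_{g\in G}\mathcal{D}_g$ by an abelian group $G$. If this grading is fine, then either all the (nonzero) homogeneous components have real dimension $1$, or it is a grading as a complex algebra, that is, $\mathcal{D}$ carries a structure of complex algebra extending its real algebra structure such that every homogeneous component $\mathcal{D}_g$ is a complex subspace.
   Context: A grading on an algebra $\mathcal{D}$ by a group $G$ is a vector space decomposition $\mathcal{D}=\bigoplus_{g\in G}\mathcal{D}_g$ with $\mathcal{D}_g\mathcal{D}_h\subseteq\mathcal{D}_{gh}$ for all $g,h\in G$. The subspaces $\mathcal{D}_g$ are the homogeneous components (some may be zero) and their elements are the homogeneous elements. A grading on a unital associative algebra is a division grading if every nonzero homogeneous element is invertible. Given two gradings on the same algebra, the first is a refinement of the second if every homogeneous component of the first is contained in a homogeneous component of the second. A grading is fine if it cannot be properly refined. *)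

theory Defs
  imports Complex_Main "HOL-Library.Countable_Set" "HOL-Algebra.Generated_Groups"
begin

text \<open>
  A unital associative real algebra is a type of sort \<open>{real_algebra, monoid_mult}\<close>. Unlike
  \<open>real_algebra_1\<close>, this sort does not impose \<open>0 \<noteq> 1\<close>, so the zero algebra is allowed.
  The grading group is an object of HOL-Algebra because fineness quantifies over grading groups.
\<close>

definition finite_dimensional_algebra :: "'a::{real_algebra,monoid_mult} itself \<Rightarrow> bool" where
  "finite_dimensional_algebra _ \<longleftrightarrow> (\<exists>B::'a set. finite B \<and> span B = UNIV)"

text \<open>
  \<open>f\<close> is a decomposition of \<open>x\<close> as a finite sum of elements of the subspaces \<open>D g\<close>, \<open>g \<in> I\<close>.
\<close>

definition homogeneous_decomposition ::
    "'g set \<Rightarrow> ('g \<Rightarrow> 'a::real_vector set) \<Rightarrow> 'a \<Rightarrow> ('g \<Rightarrow> 'a) \<Rightarrow> bool" where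
  "homogeneous_decomposition I D x f \<longleftrightarrow>
     (\<forall>g\<in>I. f g \<in> D g) \<and> (\<forall>g. g \<notin> I \<longrightarrow> f g = 0) \<and>
     finite {g. f g \<noteq> 0} \<and> x = (\<Sum>g | f g \<noteq> 0. f g)"

definition group_grading ::
    "('g, 'b) monoid_scheme \<Rightarrow> ('g \<Rightarrow> 'a::{real_algebra,monoid_mult} set) \<Rightarrow> bool" where
  "group_grading G D \<longleftrightarrow>
     group G \<and>
     (\<forall>g\<in>carrier G. subspace (D g)) \<and>
     (\<forall>x. \<exists>!f. homogeneous_decomposition (carrier G) D x f) \<and>
     (\<forall>g\<in>carrier G. \<forall>h\<in>carrier G. \<forall>x\<in>D g. \<forall>y\<in>D h. x * y \<in> D (g \<otimes>\<^bsub>G\<^esub> h))"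

definition division_grading ::
    "('g, 'b) monoid_scheme \<Rightarrow> ('g \<Rightarrow> 'a::{real_algebra,monoid_mult} set) \<Rightarrow> bool" where
  "division_grading G D \<longleftrightarrow>
     group_grading G D \<and>
     (\<forall>g\<in>carrier G. \<forall>x\<in>D g. x \<noteq> 0 \<longrightarrow> (\<exists>y. x * y = 1 \<and> y * x = 1))"

definition refinement ::
    "('h, 'c) monoid_scheme \<Rightarrow> ('h \<Rightarrow> 'a set) \<Rightarrow> ('g, 'b) monoid_scheme \<Rightarrow> ('g \<Rightarrow> 'a set) \<Rightarrow> bool"
  where
  "refinement H E G D \<longleftrightarrow> (\<forall>h\<in>carrier H. \<exists>g\<in>carrier G. E h \<subseteq> D g)"

text \<open>
  Two gradings refine each other iff they have the same nonzero components, so a refinement is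
  proper iff it is not refined in turn by the grading that it refines.
\<close>

definition proper_refinement ::
    "('h, 'c) monoid_scheme \<Rightarrow> ('h \<Rightarrow> 'a set) \<Rightarrow> ('g, 'b) monoid_scheme \<Rightarrow> ('g \<Rightarrow> 'a set) \<Rightarrow> bool"
  where
  "proper_refinement H E G D \<longleftrightarrow> refinement H E G D \<and> \<not> refinement G D H E"

text \<open>
  The refining grading may be by any group, abelian or not, unrelated to \<open>G\<close>. A definition cannot
  quantify over the type of the group elements, but groups on sets of natural numbers suffice
  for a finite-dimensional algebra: such a grading has finite support, and its group can be
  replaced by the countable subgroup that the support generates. See
  \<open>fine_grading_no_proper_refinement\<close> below.
\<close>

definition fine_grading ::
    "('g, 'b) monoid_scheme \<Rightarrow> ('g \<Rightarrow> 'a::{real_algebra,monoid_mult} set) \<Rightarrow> bool" where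
  "fine_grading G D \<longleftrightarrow>
     \<not> (\<exists>(H::nat monoid) E. group_grading H E \<and> proper_refinement H E G D)"

definition complex_algebra_structure ::
    "(complex \<Rightarrow> 'a::{real_algebra,monoid_mult} \<Rightarrow> 'a) \<Rightarrow> bool" where
  "complex_algebra_structure s \<longleftrightarrow>
     vector_space s \<and>
     (\<forall>c x y. s c x * y = s c (x * y) \<and> x * s c y = s c (x * y)) \<and>
     (\<forall>r x. s (complex_of_real r) x = r *\<^sub>R x)"

definition complex_grading ::
    "('g, 'b) monoid_scheme \<Rightarrow> ('g \<Rightarrow> 'a::{real_algebra,monoid_mult} set) \<Rightarrow> bool" where
  "complex_grading G D \<longleftrightarrow>
     (\<exists>s. complex_algebra_structure s \<and> (\<forall>g\<in>carrier G. module.subspace s (D g)))"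


lemma grading_finite_support:
  fixes E :: "'h \<Rightarrow> 'a::{real_algebra,monoid_mult} set"
  assumes fd: "finite_dimensional_algebra TYPE('a)" and gr: "group_grading H E"
  shows "finite {h \<in> carrier H. E h \<noteq> {0}}" (is "finite ?S")
proof -
  obtain B :: "'a set" where B: "finite B" "span B = UNIV"
    using fd by (auto simp: finite_dimensional_algebra_def)
  have sub: "subspace (E h)" if "h \<in> carrier H" for h
    using gr that by (simp add: group_grading_def)
  have uniq: "f = g" if "homogeneous_decomposition (carrier H) E x f"
    "homogeneous_decomposition (carrier H) E x g" for x f g
    using gr that unfolding group_grading_def by blast
  have "\<forall>h\<in>?S. \<exists>v. v \<in> E h \<and> v \<noteq> 0"
    using sub subspace_0 by fastforce
  then obtain v where v: "\<And>h. h \<in> ?S \<Longrightarrow> v h \<in> E h \<and> v h \<noteq> 0"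
    by metis
  have "card T \<le> card B" if T: "T \<subseteq> ?S" "finite T" for T
  proof -
    have key: "\<forall>h\<in>T. c h = 0" if c: "(\<Sum>h\<in>T. c h *\<^sub>R v h) = 0" for c
    proof -
      define f where "f h = (if h \<in> T then c h *\<^sub>R v h else 0)" for h
      have "(\<Sum>h | f h \<noteq> 0. f h) = (\<Sum>h\<in>T. f h)"
        using T by (intro sum.mono_neutral_left) (auto simp: f_def split: if_splits)
      also have "\<dots> = 0"
        using c by (simp add: f_def)
      finally have s: "0 = (\<Sum>h | f h \<noteq> 0. f h)" by simp
      have fin: "finite {h. f h \<noteq> 0}"
        by (rule finite_subset[OF _ T(2)]) (auto simp: f_def split: if_splits)
      have "f h \<in> E h" if "h \<in> carrier H" for h
        using that T v sub[OF that] by (auto simp: f_def subspace_0 intro: subspace_scale)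
      then have "homogeneous_decomposition (carrier H) E 0 f"
        using s fin T unfolding homogeneous_decomposition_def by (auto simp: f_def)
      moreover have "homogeneous_decomposition (carrier H) E 0 (\<lambda>_. 0)"
        using sub by (auto simp: homogeneous_decomposition_def subspace_0)
      ultimately have "f = (\<lambda>_. 0)" by (rule uniq)
      then have f0: "f h = 0" for h by simp
      show ?thesis
      proof
        fix h assume h: "h \<in> T"
        then have "v h \<noteq> 0" using T v by blast
        with f0[of h] h show "c h = 0" by (simp add: f_def)
      qed
    qed
    have inj: "inj_on v T"
    proof (rule inj_onI, rule ccontr)
      fix a b assume ab: "a \<in> T" "b \<in> T" "v a = v b" "a \<noteq> b"
      define c :: "'h \<Rightarrow> real" where "c h = (if h = a then 1 else if h = b then -1 else 0)" for h
      have "(\<Sum>h\<in>T. c h *\<^sub>R v h) = (\<Sum>h\<in>{a,b}. c h *\<^sub>R v h)"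
        using T ab by (intro sum.mono_neutral_right) (auto simp: c_def)
      also have "\<dots> = 0" using ab by (simp add: c_def)
      finally have "c a = 0" using key ab by blast
      then show False by (simp add: c_def)
    qed
    have "independent (v ` T)"
    proof (rule independent_if_scalars_zero)
      show "finite (v ` T)" using T by simp
      fix c x assume s: "(\<Sum>x\<in>v ` T. c x *\<^sub>R x) = 0" and x: "x \<in> v ` T"
      have "(\<Sum>h\<in>T. c (v h) *\<^sub>R v h) = 0"
        using s by (simp add: sum.reindex[OF inj])
      from key[OF this] x show "c x = 0" by auto
    qed
    then have "card (v ` T) \<le> card B"
      using independent_span_bound[OF B(1)] B(2) by blast
    then show ?thesis using card_image[OF inj] by simp
  qed
  then show ?thesis
    using finite_if_finite_subsets_card_bdd[of ?S "card B"] by blast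
qed

lemma grading_by_nat_group:
  fixes E :: "'h \<Rightarrow> 'a::{real_algebra,monoid_mult} set"
  assumes fd: "finite_dimensional_algebra TYPE('a)" and gr: "group_grading H E"
  obtains N :: "nat monoid" and F where "group_grading N F" "refinement N F H E" "refinement H E N F"
proof -
  interpret group H using gr by (simp add: group_grading_def)
  define S where "S = {h \<in> carrier H. E h \<noteq> {0}}"
  have "finite S" using grading_finite_support[OF fd gr] by (simp add: S_def)
  define K where "K = generate H S"
  have Ksub: "subgroup K H"
    unfolding K_def by (rule generate_is_subgroup) (auto simp: S_def)
  have SK: "S \<subseteq> K" unfolding K_def by (auto intro: generate.incl)
  define W where "W = S \<union> m_inv H ` S"
  have Kw: "\<exists>xs\<in>lists W. x = foldr (mult H) xs \<one>\<^bsub>H\<^esub>" if "x \<in> K" for x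
    using that unfolding K_def
  proof (induction rule: generate.induct)
    case one show ?case by (rule bexI[of _ "[]"]) auto
  next
    case (incl h)
    then show ?case by (intro bexI[of _ "[h]"]) (auto simp: W_def S_def)
  next
    case (inv h)
    then show ?case by (intro bexI[of _ "[inv\<^bsub>H\<^esub> h]"]) (auto simp: W_def S_def)
  next
    case (eng a b)
    then obtain xs ys where xy: "xs \<in> lists W" "ys \<in> lists W"
      "a = foldr (mult H) xs \<one>\<^bsub>H\<^esub>" "b = foldr (mult H) ys \<one>\<^bsub>H\<^esub>" by blast
    have WH: "W \<subseteq> carrier H" by (auto simp: W_def S_def)
    have cl: "foldr (mult H) zs \<one>\<^bsub>H\<^esub> \<in> carrier H" if "zs \<in> lists W" for zs
      using that WH by (induction zs) auto
    have "foldr (mult H) (zs @ ys) \<one>\<^bsub>H\<^esub> = foldr (mult H) zs \<one>\<^bsub>H\<^esub> \<otimes>\<^bsub>H\<^esub> foldr (mult H) ys \<one>\<^bsub>H\<^esub>"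
      if "zs \<in> lists W" for zs
      using that
    proof (induction zs)
      case Nil then show ?case using cl[OF xy(2)] by simp
    next
      case (Cons z zs)
      then have "z \<in> carrier H" using WH by auto
      with Cons show ?case using cl[OF xy(2)] cl[of zs]
        by (simp add: m_assoc)
    qed
    then show ?case using xy by (intro bexI[of _ "xs @ ys"]) auto
  qed
  have "K \<subseteq> (\<lambda>xs. foldr (mult H) xs \<one>\<^bsub>H\<^esub>) ` lists W" using Kw by blast
  moreover have "countable W" using \<open>finite S\<close> by (auto simp: W_def intro: countable_finite)
  ultimately have "countable K"
    by (meson countable_image countable_lists countable_subset)
  then obtain f :: "'h \<Rightarrow> nat" where inj: "inj_on f K" by (auto simp: countable_def)
  define g where "g = inv_into K f"
  have gf: "g (f x) = x" if "x \<in> K" for x using that inj by (simp add: g_def)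
  have KH: "x \<in> carrier H" if "x \<in> K" for x using that Ksub by (meson subgroup.mem_carrier)
  have K1: "\<one>\<^bsub>H\<^esub> \<in> K" and Km: "x \<in> K \<Longrightarrow> y \<in> K \<Longrightarrow> x \<otimes>\<^bsub>H\<^esub> y \<in> K"
    and Ki: "x \<in> K \<Longrightarrow> inv\<^bsub>H\<^esub> x \<in> K" for x y
    using Ksub by (auto simp: subgroup_def)
  define N :: "nat monoid" where
    "N = \<lparr>carrier = f ` K, mult = (\<lambda>a b. f (g a \<otimes>\<^bsub>H\<^esub> g b)), one = f \<one>\<^bsub>H\<^esub>\<rparr>"
  define F where "F n = E (g n)" for n
  have cN: "carrier N = f ` K" by (simp add: N_def)
  have Ng: "group N"
  proof (rule groupI)
    fix x y assume "x \<in> carrier N" "y \<in> carrier N"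
    then show "x \<otimes>\<^bsub>N\<^esub> y \<in> carrier N" by (auto simp: N_def gf Km)
  next
    show "\<one>\<^bsub>N\<^esub> \<in> carrier N" by (simp add: N_def K1)
  next
    fix x y z assume "x \<in> carrier N" "y \<in> carrier N" "z \<in> carrier N"
    then show "x \<otimes>\<^bsub>N\<^esub> y \<otimes>\<^bsub>N\<^esub> z = x \<otimes>\<^bsub>N\<^esub> (y \<otimes>\<^bsub>N\<^esub> z)"
      by (auto simp: N_def gf Km KH m_assoc)
  next
    fix x assume "x \<in> carrier N"
    then show "\<one>\<^bsub>N\<^esub> \<otimes>\<^bsub>N\<^esub> x = x" by (auto simp: N_def gf K1 KH)
  next
    fix x assume "x \<in> carrier N"
    then obtain k where "k \<in> K" "x = f k" by (auto simp: N_def)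
    then show "\<exists>y\<in>carrier N. y \<otimes>\<^bsub>N\<^esub> x = \<one>\<^bsub>N\<^esub>"
      by (intro bexI[of _ "f (inv\<^bsub>H\<^esub> k)"]) (auto simp: N_def gf Ki KH)
  qed
  have sub: "subspace (E h)" if "h \<in> carrier H" for h
    using gr that by (simp add: group_grading_def)
  have zero: "E h = {0}" if "h \<in> carrier H" "h \<notin> K" for h
    using that SK by (auto simp: S_def)
  have decomp: "\<exists>!d. homogeneous_decomposition (carrier N) F x d" for x
  proof -
    have to: "homogeneous_decomposition (carrier H) E x (\<lambda>h. if h \<in> K then d (f h) else 0)"
      (is "homogeneous_decomposition _ _ _ ?c")
      if d: "homogeneous_decomposition (carrier N) F x d" for d
    proof -
      have supp: "{n. d n \<noteq> 0} = f ` {h. ?c h \<noteq> 0}"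
        using d unfolding homogeneous_decomposition_def cN by force
      have inj': "inj_on f {h. ?c h \<noteq> 0}"
        by (rule inj_on_subset[OF inj]) (auto split: if_splits)
      have fin: "finite {h. ?c h \<noteq> 0}"
        using d supp finite_image_iff[OF inj'] by (simp add: homogeneous_decomposition_def)
      have "x = (\<Sum>n\<in>f ` {h. ?c h \<noteq> 0}. d n)"
        using d unfolding homogeneous_decomposition_def supp by blast
      also have "\<dots> = (\<Sum>h | ?c h \<noteq> 0. ?c h)"
        by (subst sum.reindex[OF inj']) (auto intro!: sum.cong split: if_splits)
      finally have "x = (\<Sum>h | ?c h \<noteq> 0. ?c h)" .
      moreover have "?c h \<in> E h" if "h \<in> carrier H" for h
        using d that sub[OF that] unfolding homogeneous_decomposition_def
        by (auto simp: cN F_def gf subspace_0)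
      ultimately show ?thesis
        using fin KH unfolding homogeneous_decomposition_def by auto
    qed
    obtain c where c: "homogeneous_decomposition (carrier H) E x c"
      and cu: "\<And>c'. homogeneous_decomposition (carrier H) E x c' \<Longrightarrow> c' = c"
      using gr unfolding group_grading_def by blast
    have c0: "c h = 0" if "h \<notin> K" for h
      using c that zero[of h] unfolding homogeneous_decomposition_def by (cases "h \<in> carrier H") auto
    define d where "d n = (if n \<in> f ` K then c (g n) else 0)" for n
    have supp: "{n. d n \<noteq> 0} = f ` {h. c h \<noteq> 0}"
    proof (intro equalityI subsetI)
      fix n assume "n \<in> {n. d n \<noteq> 0}"
      then obtain k where "k \<in> K" "n = f k" "c k \<noteq> 0"
        by (auto simp: d_def gf split: if_splits)
      then show "n \<in> f ` {h. c h \<noteq> 0}" by blast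
    next
      fix n assume "n \<in> f ` {h. c h \<noteq> 0}"
      then obtain h where h: "n = f h" "c h \<noteq> 0" by blast
      then have "h \<in> K" using c0 by blast
      with h show "n \<in> {n. d n \<noteq> 0}" by (simp add: d_def gf)
    qed
    have inj': "inj_on f {h. c h \<noteq> 0}"
      by (rule inj_on_subset[OF inj]) (use c0 in auto)
    have dc: "d (f h) = c h" if "c h \<noteq> 0" for h
    proof -
      have "h \<in> K" using that c0 by blast
      then show ?thesis by (simp add: d_def gf)
    qed
    have "(\<Sum>n | d n \<noteq> 0. d n) = (\<Sum>h | c h \<noteq> 0. c h)"
      unfolding supp by (subst sum.reindex[OF inj'])
        (auto intro!: sum.cong simp: dc)
    then have ex: "homogeneous_decomposition (carrier N) F x d"
      using c KH supp unfolding homogeneous_decomposition_def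
      by (auto simp: cN F_def d_def gf)
    show ?thesis
    proof (rule ex1I[of _ d], rule ex)
      fix d' assume d': "homogeneous_decomposition (carrier N) F x d'"
      show "d' = d"
      proof
        fix n show "d' n = d n"
        proof (cases "n \<in> f ` K")
          case True
          then obtain k where "k \<in> K" "n = f k" by blast
          then show ?thesis
            using fun_cong[OF cu[OF to[OF d']], of k] fun_cong[OF cu[OF to[OF ex]], of k] by simp
        next
          case False
          then show ?thesis using d' ex by (simp add: homogeneous_decomposition_def cN)
        qed
      qed
    qed
  qed
  have "\<forall>a\<in>carrier N. \<forall>b\<in>carrier N. \<forall>x\<in>F a. \<forall>y\<in>F b. x * y \<in> F (a \<otimes>\<^bsub>N\<^esub> b)"
    using gr KH unfolding group_grading_def by (auto simp: N_def F_def gf Km)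
  then have "group_grading N F"
    using Ng decomp sub KH unfolding group_grading_def by (auto simp: cN F_def gf)
  moreover have "refinement N F H E"
    using KH unfolding refinement_def by (auto simp: cN F_def gf)
  moreover have "refinement H E N F"
    unfolding refinement_def
  proof
    fix h assume h: "h \<in> carrier H"
    show "\<exists>n\<in>carrier N. E h \<subseteq> F n"
    proof (cases "h \<in> K")
      case True
      then show ?thesis by (intro bexI[of _ "f h"]) (auto simp: cN F_def gf)
    next
      case False
      then show ?thesis
        using zero[OF h] sub[OF KH[OF K1]] K1
        by (intro bexI[of _ "f \<one>\<^bsub>H\<^esub>"]) (auto simp: cN F_def gf subspace_0)
    qed
  qed
  ultimately show thesis by (rule that)
qed

lemma fine_grading_no_proper_refinement:
  fixes D :: "'g \<Rightarrow> 'a::{real_algebra,monoid_mult} set"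
  assumes "finite_dimensional_algebra TYPE('a)" "fine_grading G D" "group_grading H E"
  shows "\<not> proper_refinement H E G D"
proof
  assume pr: "proper_refinement H E G D"
  obtain N :: "nat monoid" and F
    where NF: "group_grading N F" "refinement N F H E" "refinement H E N F"
    using grading_by_nat_group[OF assms(1,3)] by blast
  have "proper_refinement N F G D"
    using pr NF(2,3) unfolding proper_refinement_def refinement_def by (meson order_trans)
  with NF(1) assms(2) show False by (auto simp: fine_grading_def)
qed

lemma refinement_antisym_components:
  fixes D :: "'g \<Rightarrow> 'a::{real_algebra,monoid_mult} set"
  assumes "group_grading G D" "group_grading H E" "refinement G D H E" "refinement H E G D"
  shows "D ` carrier G - {{0}} = E ` carrier H - {{0}}"
proof -
  have aux: "D ` carrier G - {{0}} \<subseteq> E ` carrier H - {{0}}"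
    if D: "group_grading G D" and ref: "refinement G D H E" "refinement H E G D"
    for G :: "('p, 'q) monoid_scheme" and D :: "'p \<Rightarrow> 'a set"
      and H :: "('r, 's) monoid_scheme" and E
  proof
    fix X assume "X \<in> D ` carrier G - {{0}}"
    then obtain g where g: "g \<in> carrier G" "X = D g" "D g \<noteq> {0}" by blast
    obtain h k where h: "h \<in> carrier H" "D g \<subseteq> E h" and k: "k \<in> carrier G" "E h \<subseteq> D k"
      using ref g(1) unfolding refinement_def by blast
    have sub: "subspace (D a)" if "a \<in> carrier G" for a
      using D that by (simp add: group_grading_def)
    obtain x where x: "x \<in> D g" "x \<noteq> 0" using g(3) subspace_0[OF sub[OF g(1)]] by blast
    have single: "homogeneous_decomposition (carrier G) D x (\<lambda>b. if b = a then x else 0)"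
      if "a \<in> carrier G" "x \<in> D a" for a
      using that x sub by (auto simp: homogeneous_decomposition_def subspace_0)
    have "x \<in> D k" using x h k by blast
    have "(\<lambda>b. if b = g then x else 0) = (\<lambda>b. if b = k then x else 0)"
      using single[OF g(1) x(1)] single[OF k(1) \<open>x \<in> D k\<close>] D
      unfolding group_grading_def by blast
    from fun_cong[OF this, of k] x have "g = k" by (auto split: if_splits)
    then have "D g = E h" using h k by blast
    then show "X \<in> E ` carrier H - {{0}}" using g h by auto
  qed
  show ?thesis using aux[OF assms(1,3,4)] aux[OF assms(2,4,3)] by blast
qed

end

theory Submission
  imports Defs "HOL-Computational_Algebra.Fundamental_Theorem_Algebra"
begin

text \<open>
  An involutive automorphism \<open>\<phi>\<close> preserving all components refines the grading, by the group
  \<open>G \<times> \<int>/2\<close>, into the \<open>\<plusminus>1\<close>-eigenspaces of \<open>\<phi>\<close>; if the grading is fine, \<open>\<phi>\<close> is therefore \<open>1\<close> or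
  \<open>-1\<close> on each component. As \<open>G\<close> is abelian, this applies to conjugation by a homogeneous \<open>x\<close>
  with central square. Suppose that the division algebra \<open>D\<^sub>e\<close> is not \<open>\<real>\<close>, so that it contains \<open>i\<close>
  with \<open>i\<^sup>2 = -1\<close>. Conjugation by \<open>i\<close> fixes \<open>1\<close>, hence \<open>i\<close> commutes with \<open>D\<^sub>e\<close>, which forces
  \<open>D\<^sub>e = \<real> + \<real>i\<close>, and \<open>i\<close> commutes or anticommutes with each component. If \<open>i\<close> is central, it
  defines the complex structure. Otherwise some homogeneous \<open>x\<close> anticommutes with \<open>i\<close>, and \<open>x\<^sup>2\<close>
  turns out to be central; but conjugation by \<open>x\<close> fixes \<open>1\<close> and negates \<open>i\<close>, both in \<open>D\<^sub>e\<close>, a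
  contradiction.
\<close>

section \<open>Elements of a division algebra are quadratic\<close>

text \<open>The same evaluation serves at elements of the possibly noncommutative algebra and at
  complex numbers, so one real polynomial can be compared at both.\<close>

definition poly_eval :: "'a::{real_algebra,monoid_mult} \<Rightarrow> real poly \<Rightarrow> 'a" where
  "poly_eval u p = (\<Sum>n\<le>degree p. coeff p n *\<^sub>R u ^ n)"

lemma poly_eval_bound:
  assumes "degree p \<le> N"
  shows "poly_eval u p = (\<Sum>n\<le>N. coeff p n *\<^sub>R u ^ n)"
  unfolding poly_eval_def using assms
  by (intro sum.mono_neutral_left) (auto simp: coeff_eq_0)

lemma poly_eval_0 [simp]: "poly_eval u 0 = 0"
  by (simp add: poly_eval_def)

lemma poly_eval_add: "poly_eval u (p + q) = poly_eval u p + poly_eval u q"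
proof -
  let ?N = "max (degree p) (degree q)"
  show ?thesis
    using poly_eval_bound[of "p + q" ?N u] poly_eval_bound[of p ?N u] poly_eval_bound[of q ?N u]
    by (simp add: degree_add_le scaleR_add_left sum.distrib)
qed

lemma poly_eval_smult: "poly_eval u (smult c p) = c *\<^sub>R poly_eval u p"
  using poly_eval_bound[of "smult c p" "degree p" u]
  by (simp add: degree_smult_le poly_eval_def scaleR_sum_right)

lemma poly_eval_pCons: "poly_eval u (pCons c p) = c *\<^sub>R 1 + u * poly_eval u p"
proof -
  have "poly_eval u (pCons c p) = (\<Sum>n\<le>Suc (degree p). coeff (pCons c p) n *\<^sub>R u ^ n)"
    by (rule poly_eval_bound) (rule degree_pCons_le)
  also have "\<dots> = c *\<^sub>R 1 + (\<Sum>n\<le>degree p. coeff p n *\<^sub>R (u * u ^ n))"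
    by (subst sum.atMost_Suc_shift) simp
  finally show ?thesis
    by (simp add: poly_eval_def sum_distrib_left)
qed

text \<open>Real scalars are central, so the Horner step \<open>poly_eval_pCons\<close> reduces
  multiplicativity to associativity and distributivity.\<close>

lemma poly_eval_mult: "poly_eval u (p * q) = poly_eval u p * poly_eval u q"
  by (induction p)
    (simp_all add: poly_eval_pCons poly_eval_add poly_eval_smult algebra_simps)

lemma poly_eval_monom: "poly_eval u (monom c n) = c *\<^sub>R u ^ n"
  by (induction n) (simp_all add: monom_0 monom_Suc poly_eval_pCons)

text \<open>The powers of \<open>u\<close> with exponents up to \<open>card B\<close> are too many
  to be linearly independent. Independence is a property of sets, so coinciding powers are treated
  separately: there a difference of two monomials annihilates \<open>u\<close>.\<close>

lemma exists_annihilating_poly: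
  fixes u :: "'a::{real_algebra,monoid_mult}"
  assumes "finite_dimensional_algebra TYPE('a)"
  obtains p where "p \<noteq> 0" "poly_eval u p = 0"
proof -
  obtain B :: "'a set" where B: "finite B" "span B = UNIV"
    using assms by (auto simp: finite_dimensional_algebra_def)
  let ?N = "card B"
  show thesis
  proof (cases "inj_on (\<lambda>n. u ^ n) {..?N}")
    case False
    then obtain m n where mn: "u ^ m = u ^ n" "m \<noteq> n" by (auto simp: inj_on_def)
    let ?p = "monom 1 m + monom (-1) n :: real poly"
    have "coeff ?p m = 1" using mn(2) by auto
    then have "?p \<noteq> 0" by (metis coeff_0 zero_neq_one)
    moreover have "poly_eval u ?p = 0"
      using mn by (simp add: poly_eval_add poly_eval_monom)
    ultimately show thesis by (rule that)
  next
    case True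
    have "\<not> independent ((\<lambda>n. u ^ n) ` {..?N})"
      using independent_span_bound[OF B(1), of "(\<lambda>n. u ^ n) ` {..?N}"] B(2) card_image[OF True]
      by auto
    then obtain c v where c: "(\<Sum>v\<in>(\<lambda>n. u ^ n) ` {..?N}. c v *\<^sub>R v) = 0"
      and v: "v \<in> (\<lambda>n. u ^ n) ` {..?N}" "c v \<noteq> 0"
      by (auto simp: dependent_finite)
    then obtain k where k: "k \<le> ?N" "c (u ^ k) \<noteq> 0" by auto
    let ?p = "\<Sum>n\<le>?N. monom (c (u ^ n)) n"
    have "coeff ?p k = (\<Sum>n\<le>?N. if n = k then c (u ^ n) else 0)"
      by (simp add: coeff_sum)
    also have "\<dots> = c (u ^ k)" using k by simp
    finally have "?p \<noteq> 0" using k by auto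
    moreover have "poly_eval u ?p = 0"
    proof -
      have "poly_eval u (\<Sum>n\<in>A. monom (c (u ^ n)) n) = (\<Sum>n\<in>A. c (u ^ n) *\<^sub>R u ^ n)"
        if "finite A" for A
        using that by (induction A) (simp_all add: poly_eval_add poly_eval_monom)
      then show ?thesis
        using c by (simp add: sum.reindex[OF True])
    qed
    ultimately show thesis by (rule that)
  qed
qed

lemma real_poly_has_complex_root:
  assumes "degree p > 0"
  obtains z :: complex where "poly_eval z p = 0"
proof -
  let ?q = "map_poly complex_of_real p"
  have deg: "degree ?q = degree p" by (rule degree_map_poly) simp
  have "\<not> constant (poly ?q)"
    using assms deg by (simp add: constant_degree)
  then obtain z where "poly ?q z = 0"
    using fundamental_theorem_of_algebra by blast
  then have "poly_eval z p = 0"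
    unfolding poly_altdef poly_eval_def deg by (simp add: coeff_map_poly scaleR_conv_of_real)
  then show thesis by (rule that)
qed

text \<open>A polynomial of least degree annihilating \<open>u\<close> has a complex root
  \<open>z\<close>, so the minimal real polynomial \<open>d\<close> of \<open>z\<close> divides it;
  the absence of zero divisors then makes \<open>d\<close> itself annihilate \<open>u\<close>.
  Asking \<open>nzd\<close> only for polynomials in \<open>u\<close> lets the lemma be applied
  inside a subalgebra.\<close>

lemma quadratic_element:
  fixes u :: "'a::{real_algebra,monoid_mult}"
  assumes fd: "finite_dimensional_algebra TYPE('a)"
    and nzd: "\<And>p q. poly_eval u p * poly_eval u q = 0 \<Longrightarrow> poly_eval u p = 0 \<or> poly_eval u q = 0"
    and nonreal: "\<And>r. u \<noteq> r *\<^sub>R 1"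
  obtains a b where "b \<noteq> 0" "(u - a *\<^sub>R 1) * (u - a *\<^sub>R 1) = - (b * b) *\<^sub>R 1"
proof -
  have one: "(1::'a) \<noteq> 0"
  proof
    assume "(1::'a) = 0"
    then have "u = 0 *\<^sub>R 1" by (metis mult.left_neutral mult_zero_left)
    with nonreal show False by blast
  qed
  obtain p0 where "p0 \<noteq> 0 \<and> poly_eval u p0 = 0"
    using exists_annihilating_poly[OF fd] by blast
  then obtain p where p: "p \<noteq> 0" "poly_eval u p = 0"
    and least: "\<And>q. q \<noteq> 0 \<Longrightarrow> poly_eval u q = 0 \<Longrightarrow> degree p \<le> degree q"
    using ex_has_least_nat[of "\<lambda>p. p \<noteq> 0 \<and> poly_eval u p = 0" p0 degree] by blast
  have "degree p > 0"
  proof (rule ccontr)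
    assume "\<not> degree p > 0"
    then obtain c where "p = [:c:]" by (auto elim: degree_eq_zeroE)
    with p one show False by (simp add: poly_eval_pCons)
  qed
  then obtain z :: complex where z: "poly_eval z p = 0"
    by (rule real_poly_has_complex_root)
  \<comment> \<open>The minimal polynomial of \<open>z\<close> over the reals: linear for real
    \<open>z\<close>, otherwise the product of \<open>X - z\<close> and
    \<open>X - cnj z\<close>.\<close>
  define d :: "real poly" where
    "d = (if Im z = 0 then [:- Re z, 1:] else [:(Re z)\<^sup>2 + (Im z)\<^sup>2, - 2 * Re z, 1:])"
  have d0: "d \<noteq> 0" and dpos: "degree d > 0" by (auto simp: d_def)
  have dz: "poly_eval z d = 0"
    by (simp add: d_def poly_eval_pCons complex_eq_iff power2_eq_square algebra_simps)
  have pz: "poly_eval z (p mod d) = 0"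
    using z dz poly_eval_add[of z "d * (p div d)" "p mod d"] by (simp add: poly_eval_mult)
  \<comment> \<open>The remainder vanishes at \<open>z\<close> but has smaller degree than
    \<open>d\<close>; for nonreal \<open>z\<close> the imaginary part of its value isolates the
    linear coefficient \<open>c\<close>.\<close>
  have "p mod d = 0"
  proof (cases "Im z = 0")
    case True
    then have "degree (p mod d) = 0"
      using degree_mod_less[OF d0, of p] by (auto simp: d_def)
    then obtain c where "p mod d = [:c:]" by (auto elim: degree_eq_zeroE)
    with pz show ?thesis by (simp add: poly_eval_pCons)
  next
    case False
    then have "degree (p mod d) \<le> 1"
      using degree_mod_less[OF d0, of p] by (auto simp: d_def)
    then have "p mod d = [:coeff (p mod d) 0, coeff (p mod d) 1:]"
      by (intro poly_eqI) (auto simp: coeff_pCons coeff_eq_0 split: nat.split)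
    then obtain b c where bc: "p mod d = [:b, c:]" by blast
    with pz have "b + Re z * c = 0" "Im z * c = 0"
      by (auto simp: poly_eval_pCons complex_eq_iff mult.commute)
    with False bc show ?thesis by simp
  qed
  then have pd: "p = d * (p div d)" using mult_div_mod_eq[of d p] by simp
  then have q0: "p div d \<noteq> 0" using p by auto
  have "degree p = degree d + degree (p div d)"
    using pd d0 q0 by (metis degree_mult_eq)
  \<comment> \<open>\<open>p div d\<close> has smaller degree than \<open>p\<close>, so by
    minimality it cannot annihilate \<open>u\<close>.\<close>
  then have "poly_eval u (p div d) \<noteq> 0"
    using least[OF q0] dpos by linarith
  then have du: "poly_eval u d = 0"
    using nzd[of d "p div d"] p(2) pd by (metis poly_eval_mult)
  have "Im z \<noteq> 0"
  proof
    assume "Im z = 0"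
    then have "u = Re z *\<^sub>R 1"
      using du by (simp add: d_def poly_eval_pCons)
    with nonreal show False by blast
  qed
  moreover from this have "(u - Re z *\<^sub>R 1) * (u - Re z *\<^sub>R 1) = - (Im z * Im z) *\<^sub>R 1"
  proof -
    have s: "u * u = (2 * Re z) *\<^sub>R u - ((Re z)\<^sup>2 + (Im z)\<^sup>2) *\<^sub>R 1"
      using du \<open>Im z \<noteq> 0\<close> by (simp add: d_def poly_eval_pCons algebra_simps eq_neg_iff_add_eq_0)
    have "(u - Re z *\<^sub>R 1) * (u - Re z *\<^sub>R 1) = u * u - (2 * Re z) *\<^sub>R u + (Re z)\<^sup>2 *\<^sub>R 1"
      by (simp add: algebra_simps power2_eq_square flip: scaleR_2)
    then show ?thesis unfolding s by (simp add: algebra_simps power2_eq_square)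
  qed
  ultimately show thesis by (rule that)
qed

section \<open>Homogeneous components\<close>

text \<open>Unique decomposition reduces to spanning plus independence: two decompositions of one
  element differ by a vanishing sum over the union of their supports.\<close>

lemma group_gradingI:
  fixes D :: "'g \<Rightarrow> 'a::{real_algebra,monoid_mult} set"
  assumes "group G"
    and sub: "\<And>g. g \<in> carrier G \<Longrightarrow> subspace (D g)"
    and mult: "\<And>g h x y. \<lbrakk>g \<in> carrier G; h \<in> carrier G; x \<in> D g; y \<in> D h\<rbrakk> \<Longrightarrow> x * y \<in> D (g \<otimes>\<^bsub>G\<^esub> h)"
    and spanning: "\<And>x. \<exists>S f. finite S \<and> S \<subseteq> carrier G \<and> (\<forall>g\<in>S. f g \<in> D g) \<and> x = sum f S"
    and indep: "\<And>S f g. \<lbrakk>finite S; S \<subseteq> carrier G; \<forall>g\<in>S. f g \<in> D g; sum f S = 0; g \<in> S\<rbrakk> \<Longrightarrow> f g = 0"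
  shows "group_grading G D"
proof -
  have "\<exists>!f. homogeneous_decomposition (carrier G) D x f" for x
  proof -
    obtain S f where f: "finite S" "S \<subseteq> carrier G" "\<forall>g\<in>S. f g \<in> D g" "x = sum f S"
      using spanning[of x] by (elim exE conjE)
    let ?f = "\<lambda>g. if g \<in> S then f g else 0"
    have "sum ?f {g. ?f g \<noteq> 0} = sum ?f S"
      using f by (intro sum.mono_neutral_left) (auto split: if_splits)
    moreover have "finite {g. ?f g \<noteq> 0}"
      by (rule finite_subset[OF _ f(1)]) (auto split: if_splits)
    ultimately have ex: "homogeneous_decomposition (carrier G) D x ?f"
      using f sub by (auto simp: homogeneous_decomposition_def subspace_0)
    have uniq: "c = d" if "homogeneous_decomposition (carrier G) D x c"
      "homogeneous_decomposition (carrier G) D x d" for c d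
    proof
      fix g
      let ?S = "{g. c g \<noteq> 0} \<union> {g. d g \<noteq> 0}"
      have fin: "finite ?S" and S: "?S \<subseteq> carrier G"
        using that by (auto simp: homogeneous_decomposition_def)
      have "sum c ?S = sum c {g. c g \<noteq> 0}" "sum d ?S = sum d {g. d g \<noteq> 0}"
        using fin by (auto intro!: sum.mono_neutral_right)
      then have "sum (\<lambda>g. c g - d g) ?S = 0"
        using that by (simp add: homogeneous_decomposition_def sum_subtractf)
      moreover have "\<forall>g\<in>?S. c g - d g \<in> D g"
        using that S sub unfolding homogeneous_decomposition_def by (meson subsetD subspace_diff)
      ultimately have "g \<in> ?S \<Longrightarrow> c g - d g = 0"
        using indep[OF fin S, of "\<lambda>g. c g - d g"] by blast
      then show "c g = d g" by fastforce
    qed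
    show ?thesis by (rule ex1I[where a = ?f], rule ex, rule uniq[OF _ ex])
  qed
  then show ?thesis
    using assms(1) sub mult unfolding group_grading_def by blast
qed

lemma grading_decomposition:
  fixes D :: "'g \<Rightarrow> 'a::{real_algebra,monoid_mult} set"
  assumes "group_grading G D"
  obtains S f where "finite S" "S \<subseteq> carrier G" "\<And>g. g \<in> carrier G \<Longrightarrow> f g \<in> D g"
    "\<And>g. g \<notin> S \<Longrightarrow> f g = 0" "x = sum f S"
proof -
  obtain f where f: "homogeneous_decomposition (carrier G) D x f"
    using assms unfolding group_grading_def by blast
  show thesis
  proof (rule that[of "{g. f g \<noteq> 0}" f])
    show "{g. f g \<noteq> 0} \<subseteq> carrier G"
      using f by (auto simp: homogeneous_decomposition_def)
  qed (use f in \<open>auto simp: homogeneous_decomposition_def\<close>)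
qed

text \<open>Extended by zero, \<open>f\<close> is a homogeneous decomposition of 0, and the zero
  function is the only one.\<close>

lemma grading_independent:
  fixes D :: "'g \<Rightarrow> 'a::{real_algebra,monoid_mult} set"
  assumes gr: "group_grading G D" and S: "finite S" "S \<subseteq> carrier G"
    and f: "\<And>g. g \<in> S \<Longrightarrow> f g \<in> D g" "sum f S = 0" and g: "g \<in> S"
  shows "f g = 0"
proof -
  have sub: "subspace (D h)" if "h \<in> carrier G" for h
    using gr that by (simp add: group_grading_def)
  let ?f = "\<lambda>g. if g \<in> S then f g else 0"
  have "sum ?f {g. ?f g \<noteq> 0} = sum ?f S"
    using S by (intro sum.mono_neutral_left) (auto split: if_splits)
  moreover have "finite {g. ?f g \<noteq> 0}"
    by (rule finite_subset[OF _ S(1)]) (auto split: if_splits)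
  ultimately have "homogeneous_decomposition (carrier G) D 0 ?f"
    using f S sub by (auto simp: homogeneous_decomposition_def subspace_0)
  moreover have "homogeneous_decomposition (carrier G) D 0 (\<lambda>_. 0)"
    using sub by (auto simp: homogeneous_decomposition_def subspace_0)
  ultimately have "?f = (\<lambda>_. 0)"
    using gr unfolding group_grading_def by blast
  from fun_cong[OF this, of g] g show ?thesis by simp
qed

text \<open>Left multiplication by an element of degree \<open>h\<close> shifts all degrees by
  \<open>h\<close>, so only one component of the right factor can contribute to a product of degree
  \<open>k\<close>. This locates the degrees of 1 and of inverses.\<close>

lemma homogeneous_product_component:
  fixes D :: "'g \<Rightarrow> 'a::{real_algebra,monoid_mult} set"
  assumes gr: "group_grading G D" and h: "h \<in> carrier G" "k \<in> carrier G"
    and S: "finite S" "S \<subseteq> carrier G" and f: "\<And>g. g \<in> carrier G \<Longrightarrow> f g \<in> D g"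
      "\<And>g. g \<notin> S \<Longrightarrow> f g = 0"
    and a: "a \<in> D h" "a * sum f S \<in> D k"
  shows "a * sum f S = a * f (inv\<^bsub>G\<^esub> h \<otimes>\<^bsub>G\<^esub> k)"
proof -
  interpret group G using gr by (simp add: group_grading_def)
  have sub: "subspace (D g)" if "g \<in> carrier G" for g
    using gr that by (simp add: group_grading_def)
  have mult: "x * y \<in> D (g \<otimes>\<^bsub>G\<^esub> g')" if "g \<in> carrier G" "g' \<in> carrier G" "x \<in> D g" "y \<in> D g'"
    for g g' x y using gr that by (simp add: group_grading_def)
  let ?j = "inv\<^bsub>G\<^esub> h \<otimes>\<^bsub>G\<^esub> k"
  \<comment> \<open>Inserting \<open>?j\<close> guarantees that \<open>k\<close> is among the
    shifted degrees \<open>?T\<close>, even when \<open>f ?j = 0\<close>.\<close>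
  let ?S = "insert ?j S"
  let ?T = "(\<lambda>g. h \<otimes>\<^bsub>G\<^esub> g) ` ?S"
  have jk: "h \<otimes>\<^bsub>G\<^esub> ?j = k" using h by (simp flip: m_assoc)
  have S': "?S \<subseteq> carrier G" using S h by simp
  have inv: "inv\<^bsub>G\<^esub> h \<otimes>\<^bsub>G\<^esub> (h \<otimes>\<^bsub>G\<^esub> g) = g" if "g \<in> carrier G" for g
    using that h by (simp flip: m_assoc)
  have inj: "inj_on (\<lambda>g. h \<otimes>\<^bsub>G\<^esub> g) ?S"
    by (rule inj_on_inverseI[of _ "\<lambda>g. inv\<^bsub>G\<^esub> h \<otimes>\<^bsub>G\<^esub> g"]) (use inv S' in blast)
  \<comment> \<open>\<open>F\<close> is the degreewise difference of two decompositions of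
    \<open>a * sum f S\<close>: into the products \<open>a * f g\<close>, and as a single element of
    degree \<open>k\<close>.\<close>
  define F where "F g = a * f (inv\<^bsub>G\<^esub> h \<otimes>\<^bsub>G\<^esub> g) - (if g = k then a * sum f S else 0)" for g
  have T: "?T \<subseteq> carrier G" using S' h by auto
  have FD: "F g \<in> D g" if "g \<in> ?T" for g
  proof -
    have g: "g \<in> carrier G" using T that by blast
    have "a * f (inv\<^bsub>G\<^esub> h \<otimes>\<^bsub>G\<^esub> g) \<in> D (h \<otimes>\<^bsub>G\<^esub> (inv\<^bsub>G\<^esub> h \<otimes>\<^bsub>G\<^esub> g))"
      by (rule mult) (simp_all add: h g a f)
    also have "h \<otimes>\<^bsub>G\<^esub> (inv\<^bsub>G\<^esub> h \<otimes>\<^bsub>G\<^esub> g) = g" using h g by (simp flip: m_assoc)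
    finally show ?thesis
      using sub[OF g] a by (auto simp: F_def intro: subspace_diff)
  qed
  have "(\<Sum>g\<in>?T. a * f (inv\<^bsub>G\<^esub> h \<otimes>\<^bsub>G\<^esub> g)) = (\<Sum>g\<in>?S. a * f g)"
    unfolding sum.reindex[OF inj] using S' inv by (intro sum.cong) auto
  also have "\<dots> = a * sum f S"
    using S f(2)[of ?j] by (simp add: sum.insert_if sum_distrib_left)
  finally have "sum F ?T = a * sum f S - (\<Sum>g\<in>?T. if g = k then a * sum f S else 0)"
    unfolding F_def by (simp add: sum_subtractf)
  also have "\<dots> = 0"
    using S(1) jk by (auto simp: image_iff)
  finally have "sum F ?T = 0" .
  moreover have "k \<in> ?T" using jk by auto
  ultimately have "F k = 0"
    using grading_independent[OF gr _ T FD] S(1) by blast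
  then show ?thesis by (simp add: F_def)
qed

text \<open>Multiplying a component \<open>f g\<close> of 1 by 1 keeps its degree, so the neutral
  component of 1 is a right identity for every \<open>f g\<close>, hence for their sum 1.\<close>

lemma one_homogeneous:
  fixes D :: "'g \<Rightarrow> 'a::{real_algebra,monoid_mult} set"
  assumes gr: "group_grading G D"
  shows "1 \<in> D \<one>\<^bsub>G\<^esub>"
proof -
  interpret group G using gr by (simp add: group_grading_def)
  obtain S f where f: "finite S" "S \<subseteq> carrier G" "\<And>g. g \<in> carrier G \<Longrightarrow> f g \<in> D g"
    "\<And>g. g \<notin> S \<Longrightarrow> f g = 0" "1 = sum f S"
    by (rule grading_decomposition[OF gr, of 1]) blast
  have "f g * f \<one>\<^bsub>G\<^esub> = f g" if "g \<in> S" for g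
  proof -
    have g: "g \<in> carrier G" using that f by blast
    show ?thesis
      using homogeneous_product_component[OF gr g g f(1-4), of "f g"] f g
      by (simp flip: f(5))
  qed
  then have "sum f S * f \<one>\<^bsub>G\<^esub> = sum f S" by (simp add: sum_distrib_right)
  then have "f \<one>\<^bsub>G\<^esub> = 1" by (simp flip: f(5))
  then show ?thesis using f(3)[of "\<one>\<^bsub>G\<^esub>"] by simp
qed

text \<open>The component of \<open>y\<close> in the inverse degree is by itself a right inverse of
  \<open>x\<close>, hence equal to \<open>y\<close>.\<close>

lemma inverse_homogeneous:
  fixes D :: "'g \<Rightarrow> 'a::{real_algebra,monoid_mult} set"
  assumes gr: "group_grading G D" and h: "h \<in> carrier G" and x: "x \<in> D h"
    and xy: "x * y = 1" "y * x = 1"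
  shows "y \<in> D (inv\<^bsub>G\<^esub> h)"
proof -
  interpret group G using gr by (simp add: group_grading_def)
  obtain S f where f: "finite S" "S \<subseteq> carrier G" "\<And>g. g \<in> carrier G \<Longrightarrow> f g \<in> D g"
    "\<And>g. g \<notin> S \<Longrightarrow> f g = 0" "y = sum f S"
    by (rule grading_decomposition[OF gr, of y]) blast
  have "x * f (inv\<^bsub>G\<^esub> h) = 1"
    using homogeneous_product_component[OF gr h one_closed f(1-4) x] one_homogeneous[OF gr] h xy
    by (simp flip: f(5))
  then have "y * (x * f (inv\<^bsub>G\<^esub> h)) = y" by simp
  then have "f (inv\<^bsub>G\<^esub> h) = y" using xy by (simp flip: mult.assoc)
  then show ?thesis using f(3)[of "inv\<^bsub>G\<^esub> h"] h by simp
qed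

section \<open>Refinement along an involutive automorphism\<close>

text \<open>The group of order two, written as exclusive or: \<open>True\<close> stands for the sign
  -1, so the operation is multiplication of signs.\<close>

definition sign_group :: "bool monoid" where
  "sign_group = \<lparr>carrier = UNIV, monoid.mult = (\<noteq>), one = False\<rparr>"

definition signed_eigenspace ::
    "('a \<Rightarrow> 'a) \<Rightarrow> ('g \<Rightarrow> 'a::real_vector set) \<Rightarrow> 'g \<times> bool \<Rightarrow> 'a set" where
  "signed_eigenspace \<phi> D = (\<lambda>(g, b). {x \<in> D g. \<phi> x = (if b then - x else x)})"

lemma group_sign_group: "group sign_group"
  by (rule groupI) (auto simp: sign_group_def)

text \<open>Halving \<open>x + \<phi> x\<close> and \<open>x - \<phi> x\<close> splits each
  component into eigenvectors, and multiplicativity of \<open>\<phi>\<close> makes the eigenvalues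
  multiply.\<close>

lemma involution_grading:
  fixes D :: "'g \<Rightarrow> 'a::{real_algebra,monoid_mult} set"
  assumes gr: "group_grading G D" and lin: "linear \<phi>"
    and hom: "\<And>x y. \<phi> (x * y) = \<phi> x * \<phi> y" and invol: "\<And>x. \<phi> (\<phi> x) = x"
    and pres: "\<And>g x. g \<in> carrier G \<Longrightarrow> x \<in> D g \<Longrightarrow> \<phi> x \<in> D g"
  shows "group_grading (G \<times>\<times> sign_group) (signed_eigenspace \<phi> D)"
proof -
  have sub: "subspace (D g)" if "g \<in> carrier G" for g
    using gr that by (simp add: group_grading_def)
  have mult: "x * y \<in> D (g \<otimes>\<^bsub>G\<^esub> h)" if "g \<in> carrier G" "h \<in> carrier G" "x \<in> D g" "y \<in> D h"
    for g h x y using gr that by (simp add: group_grading_def)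
  note \<phi> = linear_add[OF lin] linear_diff[OF lin] linear_neg[OF lin] linear_cmul[OF lin] linear_0[OF lin]
  have car: "carrier (G \<times>\<times> sign_group) = carrier G \<times> UNIV"
    by (simp add: sign_group_def)
  show ?thesis
  proof (rule group_gradingI)
    show "group (G \<times>\<times> sign_group)"
      using gr group_sign_group by (simp add: group_grading_def DirProd_group)
  next
    fix p assume "p \<in> carrier (G \<times>\<times> sign_group)"
    then obtain g b where p: "p = (g, b)" and g: "g \<in> carrier G" unfolding car by auto
    show "subspace (signed_eigenspace \<phi> D p)"
      using sub[OF g] unfolding p
      by (cases b) (simp_all add: signed_eigenspace_def subspace_def \<phi>)
  next
    fix p q x y
    assume "p \<in> carrier (G \<times>\<times> sign_group)" "q \<in> carrier (G \<times>\<times> sign_group)"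
      and xy: "x \<in> signed_eigenspace \<phi> D p" "y \<in> signed_eigenspace \<phi> D q"
    then obtain g b h c where pq: "p = (g, b)" "q = (h, c)" and gh: "g \<in> carrier G" "h \<in> carrier G"
      unfolding car by auto
    show "x * y \<in> signed_eigenspace \<phi> D (p \<otimes>\<^bsub>G \<times>\<times> sign_group\<^esub> q)"
      using xy mult[OF gh] unfolding pq
      by (cases b; cases c) (simp_all add: signed_eigenspace_def sign_group_def hom)
  next
    fix x
    obtain S f where f: "finite S" "S \<subseteq> carrier G" "\<And>g. g \<in> carrier G \<Longrightarrow> f g \<in> D g"
      "\<And>g. g \<notin> S \<Longrightarrow> f g = 0" "x = sum f S"
      by (rule grading_decomposition[OF gr, of x]) blast
    define F where "F = (\<lambda>(g, b). (1/2) *\<^sub>R (if b then f g - \<phi> (f g) else f g + \<phi> (f g)))"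
    have "sum F (S \<times> UNIV) = (\<Sum>g\<in>S. \<Sum>b\<in>UNIV. F (g, b))"
      by (simp add: sum.cartesian_product)
    also have "\<dots> = x"
      unfolding f(5) F_def UNIV_bool by (simp flip: scaleR_add_right scaleR_2)
    finally have "x = sum F (S \<times> UNIV)" by simp
    moreover have "\<forall>p\<in>S \<times> UNIV. F p \<in> signed_eigenspace \<phi> D p"
    proof clarify
      fix g b assume "g \<in> S"
      then have g: "g \<in> carrier G" using f by blast
      show "F (g, b) \<in> signed_eigenspace \<phi> D (g, b)"
        using sub[OF g] f(3)[OF g] pres[OF g]
        by (auto simp: F_def signed_eigenspace_def \<phi> invol algebra_simps
            intro!: subspace_scale subspace_add subspace_diff)
    qed
    ultimately show "\<exists>S F. finite S \<and> S \<subseteq> carrier (G \<times>\<times> sign_group)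
        \<and> (\<forall>p\<in>S. F p \<in> signed_eigenspace \<phi> D p) \<and> x = sum F S"
      using f(1,2) unfolding car by (intro exI[of _ "S \<times> UNIV"] exI[of _ F]) auto
  next
    fix S F p
    assume S: "finite S" "S \<subseteq> carrier (G \<times>\<times> sign_group)"
      and F: "\<forall>p\<in>S. F p \<in> signed_eigenspace \<phi> D p" "sum F S = 0" and p: "p \<in> S"
    \<comment> \<open>Extension by zero makes both signs available over every degree, so the sum can
      be grouped by the first coordinate.\<close>
    define E where "E q = (if q \<in> S then F q else 0)" for q
    let ?S = "fst ` S"
    have S': "finite ?S" "?S \<subseteq> carrier G" using S unfolding car by auto
    have E: "E (g, b) \<in> D g" "\<phi> (E (g, b)) = (if b then - E (g, b) else E (g, b))"
      if "g \<in> carrier G" for g b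
    proof -
      have "E (g, b) \<in> signed_eigenspace \<phi> D (g, b)"
      proof (cases "(g, b) \<in> S")
        case True
        then show ?thesis using F(1) unfolding E_def by (metis (full_types))
      next
        case False
        then show ?thesis
          using subspace_0[OF sub[OF that]] by (simp add: E_def signed_eigenspace_def \<phi>)
      qed
      then show "E (g, b) \<in> D g" "\<phi> (E (g, b)) = (if b then - E (g, b) else E (g, b))"
        by (simp_all add: signed_eigenspace_def)
    qed
    have "(\<Sum>g\<in>?S. E (g, True) + E (g, False)) = (\<Sum>g\<in>?S. \<Sum>b\<in>UNIV. E (g, b))"
      by (simp add: UNIV_bool add.commute)
    also have "\<dots> = sum E (?S \<times> UNIV)"
      by (simp add: sum.cartesian_product)
    also have "\<dots> = sum E S"
      using S' by (intro sum.mono_neutral_right) (force simp: E_def)+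
    also have "\<dots> = 0"
      using F(2) by (simp add: E_def)
    finally have zero: "(\<Sum>g\<in>?S. E (g, True) + E (g, False)) = 0" .
    have *: "E (g, True) + E (g, False) = 0" if "g \<in> ?S" for g
    proof (rule grading_independent[OF gr S', of "\<lambda>g. E (g, True) + E (g, False)"])
      fix h assume "h \<in> ?S"
      then have h: "h \<in> carrier G" using S' by blast
      show "E (h, True) + E (h, False) \<in> D h" by (rule subspace_add[OF sub[OF h] E(1)[OF h] E(1)[OF h]])
    qed (use that zero in simp_all)
    obtain g b where gb: "p = (g, b)" "g \<in> ?S"
      using imageI[OF p, of fst] by (cases p) simp
    then have g: "g \<in> carrier G" using S' by blast
    \<comment> \<open>Applying \<open>\<phi>\<close> negates only the \<open>True\<close> part, so
      the two parts are equal as well as opposite.\<close>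
    have "\<phi> (E (g, True) + E (g, False)) = 0" using *[OF gb(2)] by (simp add: \<phi>)
    then have "E (g, False) = E (g, True)" using E(2)[OF g] by (simp add: \<phi>)
    with *[OF gb(2)] have "2 *\<^sub>R E (g, True) = 0" by (simp add: scaleR_2)
    with \<open>E (g, False) = E (g, True)\<close> have "E (g, b) = 0" by (cases b) auto
    then show "F p = 0" using p gb by (simp add: E_def)
  qed
qed

text \<open>Otherwise \<open>x - \<phi> x\<close> and \<open>y + \<phi> y\<close> give nonzero
  eigenvectors with different eigenvalues in one component, and the eigenspace grading refines
  properly.\<close>

lemma fine_grading_involution:
  fixes D :: "'g \<Rightarrow> 'a::{real_algebra,monoid_mult} set"
  assumes fd: "finite_dimensional_algebra TYPE('a)" and gr: "group_grading G D"
    and fine: "fine_grading G D" and lin: "linear \<phi>"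
    and hom: "\<And>x y. \<phi> (x * y) = \<phi> x * \<phi> y" and invol: "\<And>x. \<phi> (\<phi> x) = x"
    and pres: "\<And>g x. g \<in> carrier G \<Longrightarrow> x \<in> D g \<Longrightarrow> \<phi> x \<in> D g"
    and g: "g \<in> carrier G"
  shows "(\<forall>x\<in>D g. \<phi> x = x) \<or> (\<forall>x\<in>D g. \<phi> x = - x)"
proof (rule ccontr)
  assume "\<not> ?thesis"
  then obtain x y where x: "x \<in> D g" "\<phi> x \<noteq> x" and y: "y \<in> D g" "\<phi> y \<noteq> - y" by blast
  let ?H = "G \<times>\<times> sign_group" and ?E = "signed_eigenspace \<phi> D"
  have sub: "subspace (D g)" using gr g by (simp add: group_grading_def)
  define v where "v = x - \<phi> x"
  define u where "u = y + \<phi> y"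
  have v: "v \<in> D g" "\<phi> v = - v" "v \<noteq> 0"
    using x pres[OF g] sub by (auto simp: v_def linear_diff[OF lin] invol intro: subspace_diff)
  have "u \<noteq> 0"
    using y(2) by (metis add_eq_0_iff u_def)
  with y pres[OF g] sub have u: "u \<in> D g" "\<phi> u = u" "u \<noteq> 0"
    by (auto simp: u_def linear_add[OF lin] invol intro: subspace_add)
  have "refinement ?H ?E G D"
    by (auto simp: refinement_def signed_eigenspace_def)
  moreover have "\<not> refinement G D ?H ?E"
  proof
    assume "refinement G D ?H ?E"
    then obtain h b where "D g \<subseteq> ?E (h, b)"
      using g unfolding refinement_def by fast
    then have "\<phi> v = (if b then - v else v)" "\<phi> u = (if b then - u else u)"
      using v u by (auto simp: signed_eigenspace_def)
    then have "v = - v \<or> u = - u" using v u by (cases b) auto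
    then have "2 *\<^sub>R v = 0 \<or> 2 *\<^sub>R u = 0" unfolding scaleR_2 by (metis add.right_inverse)
    with v u show False by simp
  qed
  moreover have "group_grading ?H ?E"
    using involution_grading[OF gr lin hom invol pres] .
  ultimately show False
    using fine_grading_no_proper_refinement[OF fd fine, of ?H ?E]
    by (simp add: proper_refinement_def)
qed

text \<open>Conjugation by \<open>x\<close> is an involution because \<open>x * x\<close> is
  central, and it preserves every component because \<open>G\<close> is abelian.\<close>

lemma fine_grading_conjugation:
  fixes D :: "'g \<Rightarrow> 'a::{real_algebra,monoid_mult} set"
  assumes fd: "finite_dimensional_algebra TYPE('a)" and comm: "comm_group G"
    and gr: "group_grading G D" and fine: "fine_grading G D"
    and t: "t \<in> carrier G" and x: "x \<in> D t" and inv: "x * x' = 1" "x' * x = 1"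
    and central: "\<And>a. x * x * a = a * (x * x)" and g: "g \<in> carrier G"
  shows "(\<forall>a\<in>D g. x * a = a * x) \<or> (\<forall>a\<in>D g. x * a = - (a * x))"
proof -
  interpret comm_group G by (rule comm)
  have mult: "x * y \<in> D (g \<otimes>\<^bsub>G\<^esub> h)" if "g \<in> carrier G" "h \<in> carrier G" "x \<in> D g" "y \<in> D h"
    for g h x y using gr that by (simp add: group_grading_def)
  have x'x: "x' * (x * a) = a" "x * (x' * a) = a" for a
    using inv by (simp_all flip: mult.assoc)
  let ?\<phi> = "\<lambda>a. x * a * x'"
  have "(\<forall>a\<in>D g. ?\<phi> a = a) \<or> (\<forall>a\<in>D g. ?\<phi> a = - a)"
  proof (rule fine_grading_involution[OF fd gr fine _ _ _ _ g])
    show "linear ?\<phi>" by (rule linearI) (simp_all add: algebra_simps)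
    show "?\<phi> (a * b) = ?\<phi> a * ?\<phi> b" for a b
      by (simp add: mult.assoc x'x)
    show "?\<phi> (?\<phi> a) = a" for a
    proof -
      have "?\<phi> (?\<phi> a) = x * x * a * x' * x'" by (simp add: mult.assoc)
      also have "\<dots> = a * (x * x) * x' * x'" by (simp only: central)
      also have "\<dots> = a" using inv by (simp add: mult.assoc x'x)
      finally show ?thesis .
    qed
    show "?\<phi> a \<in> D h" if h: "h \<in> carrier G" and a: "a \<in> D h" for h a
    proof -
      have "?\<phi> a \<in> D (t \<otimes>\<^bsub>G\<^esub> h \<otimes>\<^bsub>G\<^esub> inv\<^bsub>G\<^esub> t)"
        using t h a x inverse_homogeneous[OF gr t x inv] by (intro mult) auto
      also have "t \<otimes>\<^bsub>G\<^esub> h \<otimes>\<^bsub>G\<^esub> inv\<^bsub>G\<^esub> t = h"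
        using t h by (simp add: m_comm[OF t h] m_assoc)
      finally show ?thesis .
    qed
  qed
  moreover have "x * a = a * x" if "?\<phi> a = a" for a
  proof -
    have "x * a = ?\<phi> a * x" using inv by (simp add: mult.assoc)
    with that show ?thesis by simp
  qed
  moreover have "x * a = - (a * x)" if "?\<phi> a = - a" for a
  proof -
    have "x * a = ?\<phi> a * x" using inv by (simp add: mult.assoc)
    with that show ?thesis by simp
  qed
  ultimately show ?thesis by blast
qed

section \<open>The neutral component\<close>

lemma homogeneous_zero_divisor:
  fixes D :: "'g \<Rightarrow> 'a::{real_algebra,monoid_mult} set"
  assumes "division_grading G D" "g \<in> carrier G" "x \<in> D g" "x * y = 0"
  shows "x = 0 \<or> y = 0"
  using assms unfolding division_grading_def
  by (metis mult.assoc mult.left_neutral mult_zero_right)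

text \<open>All polynomials in \<open>u\<close> stay in the neutral component, which has no zero
  divisors, so \<open>quadratic_element\<close> applies; subtracting \<open>a\<close> and dividing
  by \<open>b\<close> normalises the square to -1.\<close>

lemma neutral_component_imaginary_unit:
  fixes D :: "'g \<Rightarrow> 'a::{real_algebra,monoid_mult} set"
  assumes fd: "finite_dimensional_algebra TYPE('a)" and div: "division_grading G D"
    and u: "u \<in> D \<one>\<^bsub>G\<^esub>" and nonreal: "\<And>r. u \<noteq> r *\<^sub>R 1"
  obtains i a b where "i \<in> D \<one>\<^bsub>G\<^esub>" "i * i = - 1" "u = a *\<^sub>R 1 + b *\<^sub>R i"
proof -
  have gr: "group_grading G D" using div by (simp add: division_grading_def)
  interpret group G using gr by (simp add: group_grading_def)
  have sub: "subspace (D \<one>\<^bsub>G\<^esub>)" using gr by (simp add: group_grading_def)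
  have mult: "x * y \<in> D \<one>\<^bsub>G\<^esub>" if "x \<in> D \<one>\<^bsub>G\<^esub>" "y \<in> D \<one>\<^bsub>G\<^esub>" for x y
    using gr that unfolding group_grading_def by (metis l_one one_closed)
  note one = one_homogeneous[OF gr]
  have "poly_eval u p \<in> D \<one>\<^bsub>G\<^esub>" for p
    using sub u one
    by (induction p) (auto simp: poly_eval_pCons subspace_0 intro: subspace_add subspace_scale mult)
  then have "poly_eval u p = 0 \<or> poly_eval u q = 0" if "poly_eval u p * poly_eval u q = 0" for p q
    using homogeneous_zero_divisor[OF div one_closed] that by blast
  then obtain a b where b: "b \<noteq> 0" and ab: "(u - a *\<^sub>R 1) * (u - a *\<^sub>R 1) = - (b * b) *\<^sub>R 1"
    using quadratic_element[OF fd _ nonreal] by metis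
  show thesis
  proof (rule that[of "(1 / b) *\<^sub>R (u - a *\<^sub>R 1)" a b])
    show "(1 / b) *\<^sub>R (u - a *\<^sub>R 1) \<in> D \<one>\<^bsub>G\<^esub>"
      using sub u one by (intro subspace_scale subspace_diff)
    show "(1 / b) *\<^sub>R (u - a *\<^sub>R 1) * (1 / b) *\<^sub>R (u - a *\<^sub>R 1) = - 1"
      using b by (simp add: ab)
    show "u = a *\<^sub>R 1 + b *\<^sub>R (1 / b) *\<^sub>R (u - a *\<^sub>R 1)"
      using b by simp
  qed
qed

text \<open>A nonreal \<open>u\<close> lies in the span of 1 and some square root \<open>j\<close>
  of -1. As \<open>i\<close> and \<open>j\<close> commute, \<open>(j - i) * (j + i) = 0\<close>,
  which leaves only \<open>j = i\<close> or \<open>j = - i\<close>.\<close>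

lemma neutral_component_eq_complex:
  fixes D :: "'g \<Rightarrow> 'a::{real_algebra,monoid_mult} set"
  assumes fd: "finite_dimensional_algebra TYPE('a)" and div: "division_grading G D"
    and i: "i \<in> D \<one>\<^bsub>G\<^esub>" "i * i = - 1" and comm: "\<And>x. x \<in> D \<one>\<^bsub>G\<^esub> \<Longrightarrow> i * x = x * i"
    and u: "u \<in> D \<one>\<^bsub>G\<^esub>"
  obtains a b where "u = a *\<^sub>R 1 + b *\<^sub>R i"
proof (cases "\<exists>r. u = r *\<^sub>R 1")
  case True
  then obtain r where "u = r *\<^sub>R 1 + 0 *\<^sub>R i" by auto
  then show thesis by (rule that)
next
  case False
  have gr: "group_grading G D" using div by (simp add: division_grading_def)
  interpret group G using gr by (simp add: group_grading_def)
  have sub: "subspace (D \<one>\<^bsub>G\<^esub>)" using gr by (simp add: group_grading_def)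
  obtain j a b where j: "j \<in> D \<one>\<^bsub>G\<^esub>" "j * j = - 1" "u = a *\<^sub>R 1 + b *\<^sub>R j"
    using neutral_component_imaginary_unit[OF fd div u] False by metis
  have "(j - i) * (j + i) = 0"
    using i j comm[OF j(1)] by (simp add: algebra_simps)
  then have "j - i = 0 \<or> j + i = 0"
    using homogeneous_zero_divisor[OF div one_closed, of "j - i"] subspace_diff[OF sub j(1) i(1)]
    by blast
  then have "j = i \<or> j = - i" by (simp add: eq_neg_iff_add_eq_0)
  then have "u = a *\<^sub>R 1 + b *\<^sub>R i \<or> u = a *\<^sub>R 1 + (- b) *\<^sub>R i" using j(3) by auto
  then show thesis using that by blast
qed

text \<open>Right multiplication by the inverse of a nonzero \<open>x\<close> in \<open>D g\<close>
  maps \<open>D g\<close> into the neutral component, so \<open>D g\<close> consists of real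
  multiples of \<open>x\<close>.\<close>

lemma real_neutral_component_dim:
  fixes D :: "'g \<Rightarrow> 'a::{real_algebra,monoid_mult} set"
  assumes div: "division_grading G D" and real: "\<And>u. u \<in> D \<one>\<^bsub>G\<^esub> \<Longrightarrow> \<exists>r. u = r *\<^sub>R 1"
    and g: "g \<in> carrier G" "D g \<noteq> {0}"
  shows "dim (D g) = 1"
proof -
  have gr: "group_grading G D" using div by (simp add: division_grading_def)
  interpret group G using gr by (simp add: group_grading_def)
  have sub: "subspace (D g)" using gr g by (simp add: group_grading_def)
  obtain x where x: "x \<in> D g" "x \<noteq> 0" using g(2) subspace_0[OF sub] by blast
  obtain y where y: "x * y = 1" "y * x = 1"
    using div g x unfolding division_grading_def by blast
  have "D g \<subseteq> span {x}"
  proof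
    fix z assume z: "z \<in> D g"
    have "z * y \<in> D (g \<otimes>\<^bsub>G\<^esub> inv\<^bsub>G\<^esub> g)"
      using gr z g(1) inverse_homogeneous[OF gr g(1) x(1) y] inv_closed[OF g(1)]
      unfolding group_grading_def by blast
    then obtain r where "z * y = r *\<^sub>R 1" using real g by auto
    then have "z * y * x = r *\<^sub>R x" by simp
    then have "z = r *\<^sub>R x" using y by (simp add: mult.assoc)
    then show "z \<in> span {x}" by (simp add: span_base span_scale)
  qed
  moreover have "{x} \<subseteq> D g" "independent {x}" using x by simp_all
  ultimately show ?thesis
    using dim_unique[of "{x}" "D g" 1] by simp
qed

section \<open>Torsion of degrees and centrality of squares\<close>

lemma homogeneous_power:
  fixes D :: "'g \<Rightarrow> 'a::{real_algebra,monoid_mult} set"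
  assumes gr: "group_grading G D" and "g \<in> carrier G" "x \<in> D g"
  shows "x ^ n \<in> D (g [^]\<^bsub>G\<^esub> n)"
proof -
  interpret group G using gr by (simp add: group_grading_def)
  show ?thesis
  proof (induction n)
    case 0
    then show ?case using one_homogeneous[OF gr] by simp
  next
    case (Suc n)
    then show ?case
      using gr assms(2,3) unfolding power_Suc2 group_grading_def by simp
  qed
qed

text \<open>Since no power of \<open>x\<close> vanishes, all powers of \<open>g\<close> lie in the
  finite support of the grading, so two of them coincide.\<close>

lemma homogeneous_torsion:
  fixes D :: "'g \<Rightarrow> 'a::{real_algebra,monoid_mult} set"
  assumes fd: "finite_dimensional_algebra TYPE('a)" and gr: "group_grading G D"
    and g: "g \<in> carrier G" and x: "x \<in> D g" "\<And>n. x ^ n \<noteq> 0"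
  obtains n :: nat where "n > 0" "g [^]\<^bsub>G\<^esub> n = \<one>\<^bsub>G\<^esub>"
proof -
  interpret group G using gr by (simp add: group_grading_def)
  let ?p = "\<lambda>n::nat. g [^]\<^bsub>G\<^esub> n"
  have "range ?p \<subseteq> {h \<in> carrier G. D h \<noteq> {0}}"
    using homogeneous_power[OF gr g x(1)] x(2) g by auto
  then have "finite (range ?p)"
    using grading_finite_support[OF fd gr] finite_subset by blast
  then have "\<not> inj ?p" using finite_imageD infinite_UNIV_nat by blast
  then obtain m n where "?p m = ?p n" "m \<noteq> n" by (auto simp: inj_def)
  then obtain m n where "?p m = ?p n" "n < m" by (metis linorder_neqE_nat)
  then show thesis
    using g that[of "m - n"] pow_eq_div2[of g m n] by simp
qed

text \<open>
  If a homogeneous \<open>y\<close> commutes with \<open>i\<close>, then \<open>x y = z y x\<close> with \<open>z \<in> D\<^sub>e\<close> complex, and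
  \<open>x z = cnj z x\<close> gives \<open>x\<^sup>2 y = \<bar>z\<bar>\<^sup>2 y x\<^sup>2\<close>. Some power of \<open>y\<close> lies in \<open>D\<^sub>e\<close>, hence commutes with \<open>x\<^sup>2\<close>,
  so \<open>\<bar>z\<bar> = 1\<close>. If \<open>y\<close> anticommutes with \<open>i\<close>, then \<open>x y\<close> commutes with it.
\<close>

lemma square_central:
  fixes D :: "'g \<Rightarrow> 'a::{real_algebra,monoid_mult} set"
  assumes fd: "finite_dimensional_algebra TYPE('a)" and comm: "comm_group G"
    and div: "division_grading G D"
    and i: "i * i = - 1" and complex: "\<And>u. u \<in> D \<one>\<^bsub>G\<^esub> \<Longrightarrow> \<exists>a b. u = a *\<^sub>R 1 + b *\<^sub>R i"
    and i_comm: "\<And>g. g \<in> carrier G \<Longrightarrow>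
      (\<forall>y\<in>D g. i * y = y * i) \<or> (\<forall>y\<in>D g. i * y = - (y * i))"
    and t: "t \<in> carrier G" and x: "x \<in> D t" "x \<noteq> 0" and xi: "i * x = - (x * i)"
  shows "x * x * y = y * (x * x)"
proof -
  have gr: "group_grading G D" using div by (simp add: division_grading_def)
  interpret comm_group G by (rule comm)
  have mult: "x * y \<in> D (g \<otimes>\<^bsub>G\<^esub> h)" if "g \<in> carrier G" "h \<in> carrier G" "x \<in> D g" "y \<in> D h"
    for g h x y using gr that by (simp add: group_grading_def)
  have inverse: "\<exists>z. y * z = 1 \<and> z * y = 1" if "g \<in> carrier G" "y \<in> D g" "y \<noteq> 0" for g y
    using div that by (simp add: division_grading_def)
  obtain x' where x': "x * x' = 1" "x' * x = 1" using inverse[OF t x] by blast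
  have one: "(1::'a) \<noteq> 0" using x by (metis mult.left_neutral mult_zero_left)
  have xi': "x * i = - (i * x)" using xi by simp
  \<comment> \<open>Moving \<open>x\<close> past an element of the neutral component acts as complex
    conjugation on it.\<close>
  have conj: "x * (a *\<^sub>R 1 + b *\<^sub>R i) = (a *\<^sub>R 1 - b *\<^sub>R i) * x" for a b
    by (simp add: algebra_simps xi')
  have xxi: "x * x * i = i * (x * x)"
    by (simp add: mult.assoc xi') (simp add: xi' flip: mult.assoc)
  have commuting: "x * x * y = y * (x * x)"
    if g: "g \<in> carrier G" and y: "y \<in> D g" and iy: "i * y = y * i" for g y
  proof (cases "y = 0")
    case False
    obtain y' where y': "y * y' = 1" "y' * y = 1" using inverse[OF g y False] by blast
    \<comment> \<open>The commutator of \<open>x\<close> and \<open>y\<close> has trivial degree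
      because \<open>G\<close> is abelian, so it is a complex number.\<close>
    have "x * y * x' * y' \<in> D (t \<otimes>\<^bsub>G\<^esub> g \<otimes>\<^bsub>G\<^esub> inv\<^bsub>G\<^esub> t \<otimes>\<^bsub>G\<^esub> inv\<^bsub>G\<^esub> g)"
      using t g x y inverse_homogeneous[OF gr t x(1) x'] inverse_homogeneous[OF gr g y y']
      by (intro mult) auto
    also have "t \<otimes>\<^bsub>G\<^esub> g \<otimes>\<^bsub>G\<^esub> inv\<^bsub>G\<^esub> t \<otimes>\<^bsub>G\<^esub> inv\<^bsub>G\<^esub> g = \<one>\<^bsub>G\<^esub>"
      using t g by (simp add: m_comm[OF t g] m_assoc)
    finally obtain a b where ab: "x * y * x' * y' = a *\<^sub>R 1 + b *\<^sub>R i"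
      using complex by blast
    have xy: "x * y = (a *\<^sub>R 1 + b *\<^sub>R i) * y * x"
    proof -
      have "(a *\<^sub>R 1 + b *\<^sub>R i) * y * x = x * y * (x' * (y' * y) * x)"
        by (simp add: mult.assoc flip: ab)
      then show ?thesis using x' y' by simp
    qed
    \<comment> \<open>The squared modulus of \<open>a + b i\<close>; it arises because
      \<open>x\<close> passes this number twice, once conjugating it.\<close>
    define r where "r = a * a + b * b"
    have norm: "(a *\<^sub>R 1 - b *\<^sub>R i) * (a *\<^sub>R 1 + b *\<^sub>R i) = r *\<^sub>R 1"
      by (simp add: r_def algebra_simps i)
    have "x * x * y = x * (a *\<^sub>R 1 + b *\<^sub>R i) * (y * x)"
      by (simp add: xy mult.assoc)
    also have "\<dots> = (a *\<^sub>R 1 - b *\<^sub>R i) * (x * y) * x"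
      unfolding conj by (simp add: mult.assoc)
    also have "\<dots> = (a *\<^sub>R 1 - b *\<^sub>R i) * (a *\<^sub>R 1 + b *\<^sub>R i) * (y * (x * x))"
      unfolding xy by (simp add: mult.assoc)
    finally have r: "x * x * y = r *\<^sub>R (y * (x * x))"
      unfolding norm by simp
    \<comment> \<open>Powers of \<open>y\<close> turn the factor into \<open>r ^ n\<close>, which a
      power lying in the neutral component forces to be 1.\<close>
    have rn: "x * x * y ^ n = (r ^ n) *\<^sub>R (y ^ n * (x * x))" for n
    proof (induction n)
      case (Suc n)
      have "x * x * y ^ Suc n = (x * x * y) * y ^ n" by (simp add: mult.assoc)
      also have "\<dots> = r *\<^sub>R (y * (x * x * y ^ n))" unfolding r by (simp add: mult.assoc)
      also have "\<dots> = (r ^ Suc n) *\<^sub>R (y ^ Suc n * (x * x))"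
        unfolding Suc.IH by (simp add: mult.assoc)
      finally show ?case .
    qed simp
    have unit: "y' ^ n * y ^ n = 1" for n
      using y' by (metis left_right_inverse_power)
    then have "y ^ n \<noteq> 0" for n using one by (metis mult_zero_right)
    then obtain n :: nat where n: "n > 0" "g [^]\<^bsub>G\<^esub> n = \<one>\<^bsub>G\<^esub>"
      by (rule homogeneous_torsion[OF fd gr g y])
    have "y ^ n \<in> D \<one>\<^bsub>G\<^esub>" using homogeneous_power[OF gr g y, of n] n(2) by simp
    then obtain c d where "y ^ n = c *\<^sub>R 1 + d *\<^sub>R i" using complex by blast
    then have "x * x * y ^ n = y ^ n * (x * x)" by (simp add: algebra_simps xxi[unfolded mult.assoc])
    then have "(1 - r ^ n) *\<^sub>R (y ^ n * (x * x)) = 0"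
      using rn[of n] by (simp add: scaleR_diff_left)
    moreover have "y ^ n * (x * x) \<noteq> 0"
    proof
      assume "y ^ n * (x * x) = 0"
      then have "y' ^ n * (y ^ n * (x * x)) * x' = 0" by simp
      then have "y' ^ n * y ^ n * x * (x * x') = 0" by (simp add: mult.assoc)
      with x x' unit show False by simp
    qed
    ultimately have "r ^ n = 1" by simp
    \<comment> \<open>Nonnegativity excludes \<open>r = -1\<close>, which \<open>r ^ n = 1\<close>
      alone would allow for even \<open>n\<close>.\<close>
    moreover have "r \<ge> 0" by (simp add: r_def)
    ultimately have "r = 1" using n(1) power_eq_imp_eq_base[of r n 1] by simp
    with r show ?thesis by simp
  qed simp
  have homogeneous: "x * x * y = y * (x * x)" if g: "g \<in> carrier G" and y: "y \<in> D g" for g y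
  proof -
    consider "i * y = y * i" | "i * y = - (y * i)" using i_comm[OF g] y by blast
    then show ?thesis
    proof cases
      case 1
      then show ?thesis using commuting[OF g y] by blast
    next
      case 2
      have "i * (x * y) = i * x * y" by (simp add: mult.assoc)
      also have "\<dots> = x * y * i" unfolding xi by (simp add: mult.assoc 2)
      finally have "x * x * (x * y) = x * y * (x * x)"
        using commuting[OF _ mult[OF t g x(1) y]] t g by simp
      \<comment> \<open>The settled case applied to \<open>x * y\<close> differs from the goal by a
        left factor \<open>x\<close>, which \<open>x'\<close> cancels.\<close>
      then have "x' * x * (x * x * y) = x' * x * (y * (x * x))"
        by (simp add: mult.assoc)
      then show ?thesis using x' by simp
    qed
  qed
  obtain S f where f: "S \<subseteq> carrier G" "\<And>g. g \<in> carrier G \<Longrightarrow> f g \<in> D g" "y = sum f S"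
    by (rule grading_decomposition[OF gr, of y]) blast
  have "(\<Sum>g\<in>S. x * x * f g) = (\<Sum>g\<in>S. f g * (x * x))"
    using f homogeneous by (intro sum.cong) auto
  then show ?thesis unfolding f(3) by (simp add: sum_distrib_left sum_distrib_right)
qed

section \<open>The complex structure and the final case distinction\<close>

lemma central_imaginary_unit_complex_grading:
  fixes D :: "'g \<Rightarrow> 'a::{real_algebra,monoid_mult} set"
  assumes gr: "group_grading G D" and i: "i \<in> D \<one>\<^bsub>G\<^esub>" "i * i = - 1"
    and central: "\<And>y. i * y = y * i"
  shows "complex_grading G D"
proof -
  interpret group G using gr by (simp add: group_grading_def)
  have ii: "i * (i * x) = - x" for x using i(2) by (simp flip: mult.assoc)
  have xi: "x * (i * y) = i * (x * y)" for x y by (metis central mult.assoc)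
  \<comment> \<open>A scalar acts as multiplication by \<open>Re c + Im c * i\<close>: centrality of
    \<open>i\<close> makes the product complex bilinear, and its neutral degree keeps every
    component stable.\<close>
  define s where "s c x = Re c *\<^sub>R x + Im c *\<^sub>R (i * x)" for c x
  have vs: "vector_space s"
    by unfold_locales (simp_all add: s_def algebra_simps ii)
  have "complex_algebra_structure s"
    unfolding complex_algebra_structure_def using vs
    by (simp add: s_def algebra_simps xi)
  moreover have "module.subspace s (D g)" if g: "g \<in> carrier G" for g
  proof -
    have sub: "subspace (D g)" using gr g by (simp add: group_grading_def)
    have "i * x \<in> D g" if "x \<in> D g" for x
      using gr i(1) g that unfolding group_grading_def by (metis l_one one_closed)
    moreover have "module s" using vs by (simp add: module_iff_vector_space)
    ultimately show ?thesis
      using sub by (auto simp: module.subspace_def s_def subspace_0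
          intro: subspace_add subspace_scale)
  qed
  ultimately show ?thesis unfolding complex_grading_def by blast
qed

theorem theorem2p2:
  fixes G :: "('g, 'b) monoid_scheme"
    and D :: "'g \<Rightarrow> 'a::{real_algebra,monoid_mult} set"
  assumes "finite_dimensional_algebra TYPE('a)"
    and "comm_group G"
    and "division_grading G D"
    and "fine_grading G D"
  shows "(\<forall>g\<in>carrier G. D g \<noteq> {0} \<longrightarrow> dim (D g) = 1) \<or> complex_grading G D"
proof (cases "\<forall>u\<in>D \<one>\<^bsub>G\<^esub>. \<exists>r. u = r *\<^sub>R 1")
  case True
  then show ?thesis using real_neutral_component_dim[OF assms(3)] by blast
next
  case False
  note fd = assms(1) and comm = assms(2) and div = assms(3) and fine = assms(4)
  have gr: "group_grading G D" using div by (simp add: division_grading_def)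
  interpret comm_group G by (rule comm)
  obtain u where u: "u \<in> D \<one>\<^bsub>G\<^esub>" "\<And>r. u \<noteq> r *\<^sub>R 1" using False by blast
  obtain i where i: "i \<in> D \<one>\<^bsub>G\<^esub>" "i * i = - 1"
    using neutral_component_imaginary_unit[OF fd div u] by blast
  have one: "(1::'a) \<noteq> 0"
  proof
    assume "(1::'a) = 0"
    then have "u = 0 *\<^sub>R 1" by (metis mult.left_neutral mult_zero_left)
    with u show False by blast
  qed
  have not_both: "\<not> (a = b \<and> a = - b)" if "a \<noteq> 0" for a b :: 'a
  proof
    assume "a = b \<and> a = - b"
    then have "a + a = 0" by (metis add.right_inverse)
    with that show False by (simp flip: scaleR_2)
  qed
  have "i \<noteq> 0" using i one by auto
  \<comment> \<open>The inverse of \<open>i\<close> is \<open>- i\<close>, and its square -1 is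
    central, so conjugation by \<open>i\<close> qualifies.\<close>
  have i_comm: "(\<forall>y\<in>D g. i * y = y * i) \<or> (\<forall>y\<in>D g. i * y = - (y * i))"
    if "g \<in> carrier G" for g
    using i(2) that
    by (intro fine_grading_conjugation[OF fd comm gr fine one_closed i(1), of "- i"]) auto
  \<comment> \<open>The neutral component contains 1, which commutes with \<open>i\<close>;
    anticommuting would give \<open>i = - i\<close>.\<close>
  then have i_neutral: "i * y = y * i" if "y \<in> D \<one>\<^bsub>G\<^esub>" for y
    using that one_homogeneous[OF gr] not_both[OF \<open>i \<noteq> 0\<close>, of i] one_closed by fastforce
  show ?thesis
  proof (cases "\<forall>g\<in>carrier G. \<forall>y\<in>D g. i * y = y * i")
    case True
    have "i * y = y * i" for y
    proof -
      obtain S f where f: "S \<subseteq> carrier G" "\<And>g. g \<in> carrier G \<Longrightarrow> f g \<in> D g" "y = sum f S"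
        by (rule grading_decomposition[OF gr, of y]) blast
      have "(\<Sum>g\<in>S. i * f g) = (\<Sum>g\<in>S. f g * i)"
        using f True by (intro sum.cong) auto
      then show ?thesis unfolding f(3) by (simp add: sum_distrib_left sum_distrib_right)
    qed
    then show ?thesis using central_imaginary_unit_complex_grading[OF gr i] by blast
  next
    case False
    then obtain t x where t: "t \<in> carrier G" and x: "x \<in> D t" and ne: "i * x \<noteq> x * i" by blast
    have xi: "i * x = - (x * i)" using i_comm[OF t] x ne by blast
    have x0: "x \<noteq> 0" using ne by auto
    obtain x' where x': "x * x' = 1" "x' * x = 1"
      using div t x x0 unfolding division_grading_def by blast
    have complex: "\<exists>a b. v = a *\<^sub>R 1 + b *\<^sub>R i" if "v \<in> D \<one>\<^bsub>G\<^esub>" for v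
      using neutral_component_eq_complex[OF fd div i i_neutral that] by blast
    have "x * x * y = y * (x * x)" for y
      by (rule square_central[OF fd comm div i(2) complex i_comm t x x0 xi])
    then have "(\<forall>a\<in>D \<one>\<^bsub>G\<^esub>. x * a = a * x) \<or> (\<forall>a\<in>D \<one>\<^bsub>G\<^esub>. x * a = - (a * x))"
      by (intro fine_grading_conjugation[OF fd comm gr fine t x x']) auto
    \<comment> \<open>\<open>i\<close> excludes the first alternative and 1 the second.\<close>
    moreover have "x * i \<noteq> i * x" using ne by auto
    moreover have "x * 1 \<noteq> - (1 * x)" using not_both[OF x0, of x] by auto
    ultimately show ?thesis using i(1) one_homogeneous[OF gr] by blast
  qed
qed

end
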